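(* Let $X$ be a Banach space and let $(f_{n})_{n=1}^\infty$ be a weak$^{*}$ null sequence in $X^{*}$. Then $$\beta((f_{n})_{n=1}^\infty)\leqslant \alpha((f_{n})_{n=1}^\infty)\leqslant 2\beta((f_{n})_{n=1}^\infty).$$
   Context: Banach spaces are infinite-dimensional, over the real or complex field; $B_X$ denotes the closed unit ball of $X$, and $\mathcal F_X$ the family of all weakly compact subsets of $B_X$. For a bounded sequence $(f_n)_{n=1}^\infty$ in $X^*$ define $$\alpha((f_n)_{n=1}^\infty)=\sup_{K\in\mathcal F_X}\limsup_{n\to\infty}\sup_{x\in K}|\langle f_n,x\rangle|,$$ $$\beta((f_n)_{n=1}^\infty)=\sup\Big\{\limsup_{n\to\infty}|\langle f_n,x_n\rangle| : (x_n)_{n=1}^\infty\subseteq B_X \text{ weakly null}\Big\}.$$ *)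

theory Defs
  imports "HOL-Analysis.Analysis"
begin

text \<open>
  The scalar field is a type that is isometrically isomorphic, as a normed field over the reals,
  to the real or to the complex numbers.
\<close>

class real_or_complex_field = real_normed_field +
  assumes real_or_complex:
    "\<exists>\<phi> :: 'a \<Rightarrow> complex.
       (\<forall>a b. \<phi> (a + b) = \<phi> a + \<phi> b) \<and> (\<forall>a b. \<phi> (a * b) = \<phi> a * \<phi> b) \<and>
       (\<forall>r a. \<phi> (scaleR r a) = scaleR r (\<phi> a)) \<and> (\<forall>a. cmod (\<phi> a) = norm a) \<and>
       (range \<phi> = \<real> \<or> range \<phi> = UNIV)"

instance real :: real_or_complex_field
  by standard (rule exI[of _ complex_of_real], auto simp: Reals_def scaleR_conv_of_real)

instance complex :: real_or_complex_field
  by standard (rule exI[of _ "\<lambda>z. z"], auto)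

text \<open>
  The class \<open>banach\<close> provides the norm, its completeness and the multiplication by real
  scalars; the parameter \<open>sc\<close> is the multiplication by elements of the scalar field.
\<close>

locale banach_space_over = vector_space sc
  for sc :: "'k::real_or_complex_field \<Rightarrow> 'a::banach \<Rightarrow> 'a" +
  assumes scale_of_real: "sc (of_real r) x = scaleR r x"
    and norm_scale: "norm (sc c x) = norm c * norm x"

lemma banach_space_over_real: "banach_space_over (scaleR :: real \<Rightarrow> 'a::banach \<Rightarrow> 'a)"
  by unfold_locales (auto simp: algebra_simps)

definition infinite_dimensional ::
  "('k::real_or_complex_field \<Rightarrow> 'a::banach \<Rightarrow> 'a) \<Rightarrow> bool" where
  "infinite_dimensional sc \<longleftrightarrow> \<not> (\<exists>B. finite B \<and> module.span sc B = UNIV)"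

definition dual_space ::
  "('k::real_or_complex_field \<Rightarrow> 'a::banach \<Rightarrow> 'a) \<Rightarrow> ('a \<Rightarrow> 'k) set" where
  "dual_space sc =
     {g. Vector_Spaces.linear sc (*) g \<and> (\<exists>C. \<forall>x. norm (g x) \<le> C * norm x)}"

definition weak_topology ::
  "('k::real_or_complex_field \<Rightarrow> 'a::banach \<Rightarrow> 'a) \<Rightarrow> 'a topology" where
  "weak_topology sc =
     topology_generated_by {g -` U | g U. g \<in> dual_space sc \<and> open U}"

definition weak_star_topology ::
  "('k::real_or_complex_field \<Rightarrow> 'a::banach \<Rightarrow> 'a) \<Rightarrow> ('a \<Rightarrow> 'k) topology" where
  "weak_star_topology sc =
     topology_generated_by {{g \<in> dual_space sc. g x \<in> U} | x U. open U}"

definition weakly_compact_ball_subsets ::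
  "('k::real_or_complex_field \<Rightarrow> 'a::banach \<Rightarrow> 'a) \<Rightarrow> 'a set set" where
  "weakly_compact_ball_subsets sc = {K. K \<subseteq> cball 0 1 \<and> compactin (weak_topology sc) K}"

text \<open>
  Suprema and upper limits are taken in the extended reals, so that they always exist; for bounded
  sequences of functionals both quantities below are finite.  The empty set, whose supremum is
  \<open>-\<infinity>\<close>, does not affect \<open>alpha\<close>, since singletons are weakly compact.
\<close>

definition alpha ::
  "('k::real_or_complex_field \<Rightarrow> 'a::banach \<Rightarrow> 'a) \<Rightarrow> (nat \<Rightarrow> 'a \<Rightarrow> 'k) \<Rightarrow> ereal" where
  "alpha sc f =
     (SUP K \<in> weakly_compact_ball_subsets sc. limsup (\<lambda>n. SUP x\<in>K. ereal (norm (f n x))))"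

definition beta ::
  "('k::real_or_complex_field \<Rightarrow> 'a::banach \<Rightarrow> 'a) \<Rightarrow> (nat \<Rightarrow> 'a \<Rightarrow> 'k) \<Rightarrow> ereal" where
  "beta sc f =
     Sup {limsup (\<lambda>n. ereal (norm (f n (x n)))) | x.
            range x \<subseteq> cball 0 1 \<and> limitin (weak_topology sc) x 0 sequentially}"

end

theory Submission
  imports Defs
begin

text \<open>
  A weakly null sequence together with its limit is weakly compact, which gives the first
  inequality.  For the second, points of a weakly compact set on which the functionals are almost
  as large as possible have, by the Eberlein--Smulian theorem, a subsequence converging weakly to
  some point of the set; half the differences to this limit form a weakly null sequence in the
  unit ball, and the contribution of the limit itself disappears since the functionals converge
  pointwise to zero.
\<close>

section \<open>The Hahn--Banach theorem for sublinear functionals\<close>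

text \<open>The weak topology need not be metrizable on a weakly compact set, so the subsequence is
  extracted inside a separable closed subspace containing the sequence. Two consequences of
  Hahn--Banach make this work: such a subspace is weakly closed, and countably many functionals
  separate its points. Both come from real functionals, whereas \<open>dual_space\<close> consists
  of functionals over \<open>'k\<close>; each real one is therefore written as the real part of an
  element of \<open>dual_space\<close>. The factor 2 arises because two points of the unit ball may
  be at distance 2. A \<open>limsup\<close> supplies large values at infinitely many indices only,
  while \<open>beta\<close> asks for a sequence indexed by all naturals; the gaps are filled with
  zeros.\<close>

definition sublinear :: "('a::real_vector \<Rightarrow> real) \<Rightarrow> bool" where
  "sublinear p \<longleftrightarrow> (\<forall>x y. p (x + y) \<le> p x + p y) \<and> (\<forall>t x. 0 \<le> t \<longrightarrow> p (t *\<^sub>R x) \<le> t * p x)"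

lemma sublinear_add: "sublinear p \<Longrightarrow> p (x + y) \<le> p x + p y"
  by (simp add: sublinear_def)

lemma sublinear_scaleR_le: "sublinear p \<Longrightarrow> 0 \<le> t \<Longrightarrow> p (t *\<^sub>R x) \<le> t * p x"
  by (simp add: sublinear_def)

lemma sublinear_zero: "sublinear p \<Longrightarrow> p 0 = 0"
  using sublinear_add[of p 0 0] sublinear_scaleR_le[of p 0 0] by simp

lemma sublinear_scaleR:
  assumes "sublinear p" "0 \<le> t"
  shows "p (t *\<^sub>R x) = t * p x"
proof (cases "t = 0")
  case True
  then show ?thesis using assms by (simp add: sublinear_zero)
next
  case False
  have "p (inverse t *\<^sub>R (t *\<^sub>R x)) \<le> inverse t * p (t *\<^sub>R x)"
    using assms by (intro sublinear_scaleR_le) auto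
  then have "t * p x \<le> p (t *\<^sub>R x)"
    using False assms(2) by (simp add: field_simps)
  then show ?thesis using sublinear_scaleR_le[OF assms, of x] by simp
qed

lemma sublinear_ge_minus: "sublinear p \<Longrightarrow> - p (- x) \<le> p x"
  using sublinear_add[of p x "- x"] by (simp add: sublinear_zero)

text \<open>
  A minimal sublinear functional cannot be lowered by this step, so it is odd and hence linear.
  This yields the Hahn--Banach theorem from Zorn's lemma without extending functionals from
  subspaces.
\<close>

lemma sublinear_descent:
  assumes q: "sublinear q"
  obtains r where "sublinear r" "\<And>x. r x \<le> q x" "r (- y) \<le> - q y"
proof -
  \<comment> \<open>The parameter \<open>t = 0\<close> gives \<open>r x \<le> q x\<close>, and
    \<open>t = 1\<close> at the point \<open>- y\<close> gives
    \<open>r (- y) \<le> q 0 - q y\<close>.\<close>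
  define r where "r = (\<lambda>x. INF t\<in>{0..}. q (x + t *\<^sub>R y) - t * q y)"
  have bdd: "bdd_below ((\<lambda>t. q (x + t *\<^sub>R y) - t * q y) ` {0..})" for x
  proof (rule bdd_belowI2)
    fix t :: real assume "t \<in> {0..}"
    then have "q (t *\<^sub>R y) = t * q y" using q by (simp add: sublinear_scaleR)
    then show "- q (- x) \<le> q (x + t *\<^sub>R y) - t * q y"
      using sublinear_add[OF q, of "x + t *\<^sub>R y" "- x"] by simp
  qed
  have r_le: "r x \<le> q (x + t *\<^sub>R y) - t * q y" if "0 \<le> t" for x t
    unfolding r_def using that by (intro cINF_lower bdd) auto
  have le_r: "c \<le> r x" if "\<And>t. 0 \<le> t \<Longrightarrow> c \<le> q (x + t *\<^sub>R y) - t * q y" for c x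
    unfolding r_def using that by (intro cINF_greatest) auto
  have "r (x + x') \<le> r x + r x'" for x x'
  proof -
    \<comment> \<open>A parameter \<open>t\<close> for \<open>x\<close> and a parameter
      \<open>s\<close> for \<open>x'\<close> add up to the admissible parameter \<open>t + s\<close>
      for \<open>x + x'\<close>; the infimum is taken over \<open>s\<close> first, then over
      \<open>t\<close>.\<close>
    have "r (x + x') - r x' \<le> q (x + t *\<^sub>R y) - t * q y" if t: "0 \<le> t" for t
    proof -
      have "r (x + x') - (q (x + t *\<^sub>R y) - t * q y) \<le> q (x' + s *\<^sub>R y) - s * q y"
        if s: "0 \<le> s" for s
      proof -
        have "r (x + x') \<le> q ((x + t *\<^sub>R y) + (x' + s *\<^sub>R y)) - (t + s) * q y"
          using r_le[of "t + s" "x + x'"] s t by (simp add: algebra_simps)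
        then show ?thesis
          using sublinear_add[OF q, of "x + t *\<^sub>R y" "x' + s *\<^sub>R y"]
          by (simp add: algebra_simps)
      qed
      from le_r[OF this] show ?thesis by simp
    qed
    from le_r[OF this] show ?thesis by simp
  qed
  moreover have "r (c *\<^sub>R x) \<le> c * r x" if c: "0 \<le> c" for c x
  proof (cases "c = 0")
    case True
    then show ?thesis using r_le[of 0 0] q by (simp add: sublinear_zero)
  next
    case False
    have "r (c *\<^sub>R x) / c \<le> q (x + t *\<^sub>R y) - t * q y" if t: "0 \<le> t" for t
    proof -
      have "r (c *\<^sub>R x) \<le> q (c *\<^sub>R (x + t *\<^sub>R y)) - (c * t) * q y"
        using r_le[of "c * t" "c *\<^sub>R x"] c t by (simp add: algebra_simps)
      also have "\<dots> = c * (q (x + t *\<^sub>R y) - t * q y)"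
        by (simp only: sublinear_scaleR[OF q c]) (simp add: algebra_simps)
      finally show ?thesis using c False by (simp add: field_simps)
    qed
    from le_r[OF this] show ?thesis using c False by (simp add: field_simps)
  qed
  ultimately have "sublinear r" by (simp add: sublinear_def)
  moreover have "r x \<le> q x" for x using r_le[of 0 x] by simp
  moreover have "r (- y) \<le> - q y" using r_le[of 1 "- y"] q by (simp add: sublinear_zero)
  ultimately show thesis by (rule that)
qed

text \<open>Sublinearity and the common majorant \<open>p\<close> bound every member below by
  \<open>- p (- x)\<close>, so the infimum is a real number. Infima of sublinear functionals are not
  subadditive in general; in a chain, two members \<open>q\<close> and \<open>q'\<close> have a
  common lower member, whose subadditivity controls the sum \<open>q x + q' y\<close>.\<close>

lemma sublinear_INF_chain:
  assumes ne: "C \<noteq> {}" and sub: "\<And>q. q \<in> C \<Longrightarrow> sublinear q"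
    and dom: "\<And>q x. q \<in> C \<Longrightarrow> q x \<le> p x"
    and chain: "\<And>q q'. q \<in> C \<Longrightarrow> q' \<in> C \<Longrightarrow> q \<le> q' \<or> q' \<le> q"
  shows "sublinear (\<lambda>x. INF q\<in>C. q x)" and "\<And>q x. q \<in> C \<Longrightarrow> (INF q\<in>C. q x) \<le> q x"
proof -
  have bdd: "bdd_below ((\<lambda>q. q x) ` C)" for x
  proof (rule bdd_belowI2)
    fix q assume "q \<in> C"
    then show "- p (- x) \<le> q x"
      using sublinear_ge_minus[OF sub, of q x] dom[of q "- x"] by simp
  qed
  show lower: "(INF q\<in>C. q x) \<le> q x" if "q \<in> C" for q x
    using that by (intro cINF_lower bdd)
  have greatest: "c \<le> (INF q\<in>C. q x)" if "\<And>q. q \<in> C \<Longrightarrow> c \<le> q x" for c x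
    using that ne by (intro cINF_greatest)
  have "(INF q\<in>C. q (x + y)) \<le> (INF q\<in>C. q x) + (INF q\<in>C. q y)" for x y
  proof -
    have "(INF q\<in>C. q (x + y)) - (INF q\<in>C. q y) \<le> q x" if q: "q \<in> C" for q
    proof -
      have "(INF q\<in>C. q (x + y)) - q x \<le> q' y" if q': "q' \<in> C" for q'
      proof -
        obtain s where s: "s \<in> C" "s \<le> q" "s \<le> q'" using chain[OF q q'] q q' by auto
        have "(INF q\<in>C. q (x + y)) \<le> s x + s y"
          using lower[OF s(1), of "x + y"] sublinear_add[OF sub[OF s(1)], of x y] by simp
        then show ?thesis using le_funD[OF s(2), of x] le_funD[OF s(3), of y] by simp
      qed
      then have "(INF q\<in>C. q (x + y)) - q x \<le> (INF q\<in>C. q y)" by (rule greatest)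
      then show ?thesis by simp
    qed
    then have "(INF q\<in>C. q (x + y)) - (INF q\<in>C. q y) \<le> (INF q\<in>C. q x)" by (rule greatest)
    then show ?thesis by simp
  qed
  moreover have "(INF q\<in>C. q (t *\<^sub>R x)) \<le> t * (INF q\<in>C. q x)" if t: "0 \<le> t" for t x
  proof (cases "t = 0")
    case True
    then show ?thesis using ne lower[of _ 0] sub by (force simp: sublinear_zero)
  next
    case False
    have "(INF q\<in>C. q (t *\<^sub>R x)) / t \<le> q x" if "q \<in> C" for q
      using lower[OF that, of "t *\<^sub>R x"] sublinear_scaleR[OF sub[OF that] t, of x] False t
      by (simp add: field_simps)
    then have "(INF q\<in>C. q (t *\<^sub>R x)) / t \<le> (INF q\<in>C. q x)" by (rule greatest)
    then show ?thesis using False t by (simp add: field_simps)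
  qed
  ultimately show "sublinear (\<lambda>x. INF q\<in>C. q x)" by (simp add: sublinear_def)
qed

lemma exists_minimal_sublinear:
  assumes p: "sublinear p"
  obtains m where "sublinear m" "m \<le> p" "\<And>q. sublinear q \<Longrightarrow> q \<le> m \<Longrightarrow> q = m"
proof -
  define A where "A = {q. sublinear q \<and> q \<le> p}"
  have "\<exists>m\<in>A. \<forall>a\<in>A. a \<le> m \<longrightarrow> a = m"
  proof (rule predicate_Zorn)
    \<comment> \<open>The order is reversed, so that the maximal element given by Zorn's lemma is a
      minimal functional.\<close>
    show "partial_order_on A (relation_of (\<lambda>x y. y \<le> x) A)"
      by (rule partial_order_on_relation_ofI) auto
    fix C assume C: "C \<in> Chains (relation_of (\<lambda>x y. y \<le> x) A)"
    then have CA: "C \<subseteq> A" and chain: "\<And>q q'. q \<in> C \<Longrightarrow> q' \<in> C \<Longrightarrow> q \<le> q' \<or> q' \<le> q"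
      by (auto simp: Chains_def relation_of_def)
    show "\<exists>u\<in>A. \<forall>a\<in>C. u \<le> a"
    proof (cases "C = {}")
      case True
      then show ?thesis using p by (auto simp: A_def)
    next
      case False
      have s: "\<And>q. q \<in> C \<Longrightarrow> sublinear q" and d: "\<And>q x. q \<in> C \<Longrightarrow> q x \<le> p x"
        using CA by (auto simp: A_def le_fun_def)
      let ?u = "\<lambda>x. INF q\<in>C. q x"
      have le: "?u \<le> q" if "q \<in> C" for q
        by (rule le_funI, rule sublinear_INF_chain(2)[where p = p]) (use False s d chain that in auto)
      have "sublinear ?u"
        by (rule sublinear_INF_chain(1)[where p = p]) (use False s d chain in auto)
      moreover obtain q where "q \<in> C" using False by blast
      then have "?u \<le> p" using le[of q] CA unfolding A_def by (blast intro: order_trans)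
      ultimately have "?u \<in> A" by (simp add: A_def)
      with le show ?thesis by blast
    qed
  qed
  then obtain m where "m \<in> A" and m: "\<And>a. a \<in> A \<Longrightarrow> a \<le> m \<Longrightarrow> a = m" by blast
  show thesis
  proof (rule that)
    show "sublinear m" "m \<le> p" using \<open>m \<in> A\<close> by (auto simp: A_def)
    fix q assume "sublinear q" "q \<le> m"
    then show "q = m" using m[of q] \<open>m \<le> p\<close> by (auto simp: A_def)
  qed
qed

text \<open>One descent at \<open>x0\<close> before minimising secures the value there: a linear
  \<open>u\<close> below \<open>r\<close> satisfies \<open>- u x0 = u (- x0) \<le> - p x0\<close>,
  which together with \<open>u \<le> p\<close> forces equality.\<close>

lemma Hahn_Banach_sublinear:
  assumes p: "sublinear p"
  obtains u where "linear u" "\<And>x. u x \<le> p x" "u x0 = p x0"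
proof -
  obtain r where r: "sublinear r" "\<And>x. r x \<le> p x" "r (- x0) \<le> - p x0"
    using sublinear_descent[OF p] by blast
  obtain m where m: "sublinear m" "m \<le> r" and min: "\<And>q. sublinear q \<Longrightarrow> q \<le> m \<Longrightarrow> q = m"
    using exists_minimal_sublinear[OF r(1)] by blast
  have neg: "m (- y) = - m y" for y
  proof -
    obtain s where s: "sublinear s" "\<And>x. s x \<le> m x" "s (- y) \<le> - m y"
      using sublinear_descent[OF m(1)] by blast
    have "s = m" using s by (intro min) (auto simp: le_fun_def)
    then show ?thesis using s(3) sublinear_ge_minus[OF m(1), of "- y"] by simp
  qed
  have "linear m"
  proof (rule linearI)
    show "m (x + y) = m x + m y" for x y
      \<comment> \<open>Writing \<open>x\<close> as \<open>(x + y) + (- y)\<close> and using oddness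
        reverses the subadditivity inequality.\<close>
      using sublinear_add[OF m(1), of x y] sublinear_add[OF m(1), of "x + y" "- y"]
      by (simp add: neg)
    show "m (c *\<^sub>R x) = c *\<^sub>R m x" for c x
      using sublinear_scaleR[OF m(1), of "\<bar>c\<bar>" x] neg[of "c *\<^sub>R x"]
      by (cases "0 \<le> c") auto
  qed
  moreover have le: "m x \<le> p x" for x
    using le_funD[OF m(2), of x] r(2)[of x] by simp
  moreover have "m x0 = p x0"
    using le[of x0] le_funD[OF m(2), of "- x0"] r(3) by (simp add: neg)
  ultimately show thesis by (rule that)
qed

section \<open>Norming functionals and separation from closed subspaces\<close>

lemma sublinear_norm: "sublinear (norm :: 'a::real_normed_vector \<Rightarrow> real)"
  by (simp add: sublinear_def norm_triangle_ineq)

text \<open>This is the quotient seminorm modulo \<open>Y\<close>. Taken as the majorant in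
  \<open>Hahn_Banach_sublinear\<close>, it yields functionals that annihilate
  \<open>Y\<close>.\<close>

lemma sublinear_infdist_subspace:
  fixes Y :: "'a::real_normed_vector set"
  assumes Y: "subspace Y"
  shows "sublinear (\<lambda>x. infdist x Y)"
proof -
  have ne: "Y \<noteq> {}" using subspace_0[OF Y] by auto
  have greatest: "c \<le> infdist x Y" if "\<And>a. a \<in> Y \<Longrightarrow> c \<le> norm (x - a)" for c x
    using that ne by (auto simp: infdist_notempty dist_norm intro: cINF_greatest)
  have lower: "infdist x Y \<le> norm (x - a)" if "a \<in> Y" for x a
    using infdist_le[OF that] by (simp add: dist_norm)
  have "infdist (x + y) Y \<le> infdist x Y + infdist y Y" for x y
  proof -
    have "infdist (x + y) Y - infdist y Y \<le> norm (x - a)" if a: "a \<in> Y" for a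
    proof -
      have "infdist (x + y) Y - norm (x - a) \<le> norm (y - b)" if b: "b \<in> Y" for b
        using lower[OF subspace_add[OF Y a b], of "x + y"] norm_triangle_ineq[of "x - a" "y - b"]
        by (simp add: algebra_simps)
      from greatest[OF this] show ?thesis by simp
    qed
    from greatest[OF this] show ?thesis by simp
  qed
  moreover have "infdist (t *\<^sub>R x) Y \<le> t * infdist x Y" if t: "0 \<le> t" for t x
  proof (cases "t = 0")
    case True
    then show ?thesis using subspace_0[OF Y] by simp
  next
    case False
    have "infdist (t *\<^sub>R x) Y / t \<le> norm (x - a)" if a: "a \<in> Y" for a
    proof -
      have "infdist (t *\<^sub>R x) Y \<le> norm (t *\<^sub>R (x - a))"
        using lower[OF subspace_scale[OF Y a, of t], of "t *\<^sub>R x"] by (simp add: algebra_simps)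
      also have "\<dots> = t * norm (x - a)" using t by simp
      finally show ?thesis using False t by (simp add: field_simps)
    qed
    from greatest[OF this] show ?thesis using False t by (simp add: field_simps)
  qed
  ultimately show ?thesis by (simp add: sublinear_def)
qed

lemma bounded_linear_if_le_norm:
  fixes u :: "'a::real_normed_vector \<Rightarrow> real"
  assumes "linear u" and "\<And>x. u x \<le> norm x"
  shows "\<bar>u x\<bar> \<le> norm x" and "bounded_linear u"
proof -
  show *: "\<bar>u x\<bar> \<le> norm x" for x
    using assms(2)[of x] assms(2)[of "- x"] linear_neg[OF assms(1), of x] by auto
  show "bounded_linear u"
    using assms(1) * by (intro bounded_linear_intro[where K = 1])
      (auto simp: linear_add linear_scale)
qed

lemma norming_functional:
  fixes x0 :: "'a::real_normed_vector"
  obtains u where "bounded_linear u" "\<And>x. \<bar>u x\<bar> \<le> norm x" "u x0 = norm x0"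
proof -
  obtain u where "linear u" "\<And>x. u x \<le> norm x" "u x0 = norm x0"
    using Hahn_Banach_sublinear[OF sublinear_norm] by blast
  then show thesis using bounded_linear_if_le_norm[of u] that[of u] by blast
qed

text \<open>Domination by the distance to \<open>Y\<close>, applied to \<open>y\<close> and
  \<open>- y\<close>, makes \<open>u\<close> vanish on \<open>Y\<close>; at \<open>x0\<close> the
  distance is attained as a value and is positive because \<open>Y\<close> is closed.\<close>

lemma separating_functional_subspace:
  fixes Y :: "'a::real_normed_vector set"
  assumes Y: "subspace Y" "closed Y" and x0: "x0 \<notin> Y"
  obtains u :: "'a \<Rightarrow> real" where "bounded_linear u" "\<And>y. y \<in> Y \<Longrightarrow> u y = 0" "u x0 \<noteq> 0"
proof -
  have 0: "0 \<in> Y" using Y(1) by (rule subspace_0)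
  obtain u where u: "linear u" "\<And>x. u x \<le> infdist x Y" "u x0 = infdist x0 Y"
    using Hahn_Banach_sublinear[OF sublinear_infdist_subspace[OF Y(1)]] by blast
  have "u x \<le> norm x" for x
    using u(2)[of x] infdist_le[OF 0, of x] by simp
  with u(1) have "bounded_linear u" by (rule bounded_linear_if_le_norm)
  moreover have "u y = 0" if "y \<in> Y" for y
    using u(2)[of y] u(2)[of "- y"] linear_neg[OF u(1), of y] that subspace_neg[OF Y(1) that]
    by simp
  moreover have "u x0 \<noteq> 0"
    using u(3) in_closed_iff_infdist_zero[OF Y(2), of x0] 0 x0 by auto
  ultimately show thesis by (rule that)
qed

section \<open>The weak topology\<close>

context banach_space_over
begin

lemma dual_spaceD:
  assumes "g \<in> dual_space sc"
  shows "g (x + y) = g x + g y" "g (sc c x) = c * g x" "g (x - y) = g x - g y" "g 0 = 0"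
    "g (r *\<^sub>R x) = of_real r * g x"
proof -
  interpret g: Vector_Spaces.linear sc "(*)" g using assms by (simp add: dual_space_def)
  show "g (x + y) = g x + g y" "g (sc c x) = c * g x" "g (x - y) = g x - g y" "g 0 = 0"
    by (auto simp: g.add g.scale g.diff)
  then show "g (r *\<^sub>R x) = of_real r * g x"
    by (metis g.scale scale_of_real)
qed

lemma dual_spaceI:
  assumes "\<And>x y. g (x + y) = g x + g y" "\<And>c x. g (sc c x) = c * g x"
    "\<And>x. norm (g x) \<le> C * norm x"
  shows "g \<in> dual_space sc"
  using assms vector_space_axioms
  by (auto simp: dual_space_def Vector_Spaces.linear_iff vector_space_def algebra_simps)

lemma zero_in_dual_space: "(\<lambda>_. 0) \<in> dual_space sc"
  by (rule dual_spaceI[where C = 0]) auto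

lemma topspace_weak_topology [simp]: "topspace (weak_topology sc) = UNIV"
proof -
  have "UNIV \<in> {g -` U |g U. g \<in> dual_space sc \<and> open U}"
    using zero_in_dual_space by (intro CollectI exI[of _ "\<lambda>_. 0"] exI[of _ UNIV]) auto
  then show ?thesis unfolding weak_topology_def topology_generated_by_topspace by blast
qed

lemma continuous_map_weak_dual:
  assumes "g \<in> dual_space sc"
  shows "continuous_map (weak_topology sc) euclidean g"
proof -
  have "openin (weak_topology sc) (g -` U)" if "open U" for U
    unfolding weak_topology_def using assms that by (intro topology_generated_by_Basis) blast
  then show ?thesis by (auto simp: continuous_map_alt)
qed

text \<open>Convergence need only be tested on the generating sets, since the property of eventually
  containing the net once \<open>l\<close> is inside passes to finite intersections and arbitrary
  unions.\<close>

lemma limitin_weak_topology: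
  "limitin (weak_topology sc) x l F \<longleftrightarrow> (\<forall>g\<in>dual_space sc. ((\<lambda>n. g (x n)) \<longlongrightarrow> g l) F)"
proof
  assume "limitin (weak_topology sc) x l F"
  then show "\<forall>g\<in>dual_space sc. ((\<lambda>n. g (x n)) \<longlongrightarrow> g l) F"
    using continuous_map_limit[OF continuous_map_weak_dual] by (fastforce simp: o_def)
next
  assume R: "\<forall>g\<in>dual_space sc. ((\<lambda>n. g (x n)) \<longlongrightarrow> g l) F"
  have "\<forall>\<^sub>F n in F. x n \<in> W" if "openin (weak_topology sc) W" "l \<in> W" for W
  proof -
    have "generate_topology_on {g -` U | g U. g \<in> dual_space sc \<and> open U} W"
      using that(1) unfolding weak_topology_def by (rule openin_topology_generated_by)
    then show ?thesis using that(2)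
    proof induction
      case (Int a b)
      then show ?case by (auto simp: eventually_conj_iff)
    next
      case (UN K)
      then obtain k where k: "k \<in> K" "l \<in> k" by blast
      then have "\<forall>\<^sub>F n in F. x n \<in> k" using UN.IH by blast
      then show ?case by (rule eventually_mono) (use k in blast)
    next
      case (Basis s)
      then obtain g U where s: "s = g -` U" "g \<in> dual_space sc" "open U" by blast
      then have "\<forall>\<^sub>F n in F. g (x n) \<in> U"
        using R Basis.prems by (auto dest: topological_tendstoD)
      then show ?case using s by simp
    qed simp
  qed
  then show "limitin (weak_topology sc) x l F" by (simp add: limitin_def)
qed

text \<open>This carries the real Hahn--Banach results over to functionals over \<open>'k\<close>:
  weak continuity of \<open>g\<close> is inherited by the real functional \<open>u\<close>.\<close>

lemma bounded_real_linear_eq_Re_dual: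
  assumes u: "bounded_linear (u :: 'a \<Rightarrow> real)"
  obtains g and \<rho> :: "'k \<Rightarrow> real" where "g \<in> dual_space sc" "bounded_linear \<rho>" "u = \<rho> \<circ> g"
proof -
  obtain \<phi> :: "'k \<Rightarrow> complex" where \<phi>: "\<And>a b. \<phi> (a + b) = \<phi> a + \<phi> b" "\<And>a b. \<phi> (a * b) = \<phi> a * \<phi> b"
    "\<And>r a. \<phi> (scaleR r a) = scaleR r (\<phi> a)" "\<And>a. cmod (\<phi> a) = norm a"
    and range: "range \<phi> = \<real> \<or> range \<phi> = UNIV"
    using real_or_complex[where 'a = 'k] by blast
  have bl: "bounded_linear \<phi>"
    by (rule bounded_linear_intro[where K = 1]) (simp_all add: \<phi>)
  interpret \<phi>: bounded_linear \<phi> by (rule bl)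
  have inj: "a = b" if "\<phi> a = \<phi> b" for a b
    using \<phi>(4)[of "a - b"] that by (simp add: \<phi>.diff)
  \<comment> \<open>\<open>\<phi> 1\<close> is idempotent, and it is nonzero because
    \<open>\<phi>\<close> is isometric.\<close>
  have one: "\<phi> 1 = 1"
    using \<phi>(2)[of 1 1] \<phi>(4)[of 1] by (auto simp: mult_cancel_left1)
  have of_real: "\<phi> (of_real r) = of_real r" for r
    by (metis \<phi>(3) of_real_def one)
  have \<rho>: "bounded_linear (Re \<circ> \<phi>)"
    using bounded_linear_compose[OF bounded_linear_Re bl] by (simp add: o_def)
  interpret u: bounded_linear u by (rule u)
  obtain C where C: "0 \<le> C" "\<And>x. norm (u x) \<le> norm x * C"
    using u.nonneg_bounded by blast
  show thesis
  proof (cases "range \<phi> = \<real>")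
    case True
    define g where "g = (\<lambda>x. of_real (u x) :: 'k)"
    have "g \<in> dual_space sc"
    proof (rule dual_spaceI[where C = C])
      show "g (x + y) = g x + g y" for x y by (simp add: g_def u.add)
      show "g (sc c x) = c * g x" for c x
      proof -
        have "\<phi> c \<in> \<real>" using True by blast
        then obtain r where "\<phi> c = of_real r" by (auto elim: Reals_cases)
        then have c: "c = of_real r" by (intro inj) (simp add: of_real)
        show ?thesis by (simp add: c g_def scale_of_real u.scaleR)
      qed
      show "norm (g x) \<le> C * norm x" for x using C(2)[of x] by (simp add: g_def mult.commute)
    qed
    moreover have "u = (Re \<circ> \<phi>) \<circ> g" by (auto simp: g_def of_real)
    ultimately show ?thesis using that \<rho> by blast
  next
    case False
    then obtain j where j: "\<phi> j = \<i>" using range by (metis UNIV_I imageE)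
    have jj: "j * j = -1" by (rule inj) (simp add: \<phi>(2) j \<phi>.neg one)
    have nj: "norm j = 1" using \<phi>(4)[of j] j by simp
    \<comment> \<open>The usual complexification of a real functional, with \<open>j\<close> playing
      the role of the imaginary unit; the second term makes \<open>g\<close> commute with
      multiplication by \<open>j\<close>.\<close>
    define g where "g = (\<lambda>x. of_real (u x) - j * of_real (u (sc j x)))"
    have "g \<in> dual_space sc"
    \<comment> \<open>Each of the two terms of \<open>g\<close> is bounded by
      \<open>C * norm x\<close>, since \<open>norm j = 1\<close>.\<close>
    proof (rule dual_spaceI[where C = "2 * C"])
      show "g (x + y) = g x + g y" for x y
        by (simp add: g_def u.add scale_right_distrib algebra_simps)
      show "g (sc c x) = c * g x" for c x
      proof -
        define a b where "a = Re (\<phi> c)" and "b = Im (\<phi> c)"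
        have c: "c = of_real a + of_real b * j"
          by (rule inj) (simp add: \<phi>.add \<phi>(2) of_real j a_def b_def complex_eq_iff)
        have cx: "sc c x = a *\<^sub>R x + b *\<^sub>R sc j x"
          by (subst c) (simp only: scale_left_distrib scale_of_real flip: scale_scale)
        have "sc j (sc j x) = - x" by (simp add: jj)
        moreover have "sc j (r *\<^sub>R y) = r *\<^sub>R sc j y" for r y
          by (metis scale_left_commute scale_of_real)
        ultimately have jcx: "sc j (sc c x) = a *\<^sub>R sc j x - b *\<^sub>R x"
          by (simp add: cx scale_right_distrib)
        have ucx: "u (sc c x) = a * u x + b * u (sc j x)"
          by (simp only: cx u.add u.scaleR real_scaleR_def)
        have ujcx: "u (sc j (sc c x)) = a * u (sc j x) - b * u x"
          by (simp only: jcx u.diff u.scaleR real_scaleR_def)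
        have jjz: "j * (j * z) = - z" for z by (simp add: jj flip: mult.assoc)
        have "g (sc c x)
            = of_real (a * u x + b * u (sc j x)) - j * of_real (a * u (sc j x) - b * u x)"
          by (simp only: g_def ucx ujcx)
        also have "\<dots> = (of_real a + of_real b * j) * g x"
          by (simp add: g_def jjz algebra_simps)
        finally show ?thesis by (simp only: c[symmetric])
      qed
      show "norm (g x) \<le> 2 * C * norm x" for x
      proof -
        have "norm (g x) \<le> norm (of_real (u x) :: 'k) + norm (j * of_real (u (sc j x)))"
          unfolding g_def by (rule norm_triangle_ineq4)
        also have "\<dots> = \<bar>u x\<bar> + \<bar>u (sc j x)\<bar>" by (simp add: norm_mult nj)
        also have "\<dots> \<le> 2 * C * norm x"
          using C(2)[of x] C(2)[of "sc j x"] by (simp add: norm_scale nj algebra_simps)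
        finally show ?thesis .
      qed
    qed
    moreover have "u = (Re \<circ> \<phi>) \<circ> g" by (auto simp: g_def \<phi>.diff \<phi>(2) of_real j)
    ultimately show ?thesis using that \<rho> by blast
  qed
qed

lemma continuous_map_weak_real:
  assumes "bounded_linear (u :: 'a \<Rightarrow> real)"
  shows "continuous_map (weak_topology sc) euclidean u"
proof -
  obtain g and \<rho> :: "'k \<Rightarrow> real" where g: "g \<in> dual_space sc" "bounded_linear \<rho>" "u = \<rho> \<circ> g"
    using bounded_real_linear_eq_Re_dual[OF assms] by blast
  have "continuous_map euclidean euclidean \<rho>"
    using g(2) by (simp add: linear_continuous_on)
  then show ?thesis
    unfolding g(3) using continuous_map_weak_dual[OF g(1)] continuous_map_compose by blast
qed

text \<open>By separation, a closed subspace is the intersection of the kernels of the bounded real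
  functionals that annihilate it, and these kernels are weakly closed.\<close>

lemma closedin_weak_subspace:
  assumes Y: "Real_Vector_Spaces.subspace Y" "closed Y"
  shows "closedin (weak_topology sc) Y"
proof -
  define U where "U = {u :: 'a \<Rightarrow> real. bounded_linear u \<and> (\<forall>y\<in>Y. u y = 0)}"
  have "Y = (\<Inter>u\<in>U. {x \<in> topspace (weak_topology sc). u x \<in> {0}})"
    using separating_functional_subspace[OF Y] by (fastforce simp: U_def)
  moreover have "closedin (weak_topology sc) {x \<in> topspace (weak_topology sc). u x \<in> {0}}"
    if "u \<in> U" for u
    by (rule closedin_continuous_map_preimage[OF continuous_map_weak_real])
      (use that in \<open>auto simp: U_def\<close>)
  \<comment> \<open>The intersection must run over a nonempty family.\<close>
  moreover have "(\<lambda>_. 0) \<in> U" by (auto simp: U_def)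
  ultimately show ?thesis by (metis (no_types, lifting) closedin_INT empty_iff)
qed

end

section \<open>Weak sequential compactness\<close>

text \<open>Finite combinations with rational coefficients stay countable; real multiples are
  recovered only in the closure.\<close>

lemma countable_superset_subspace_closure:
  fixes A :: "'a::real_normed_vector set"
  assumes "countable A"
  obtains D where "countable D" "A \<subseteq> D" "subspace (closure D)"
proof -
  define comb where "comb = (\<lambda>l. sum_list (map (\<lambda>(q :: rat, a :: 'a). of_rat q *\<^sub>R a) l))"
  define D where "D = comb ` lists (UNIV \<times> A)"
  have "countable D" unfolding D_def using assms by auto
  moreover have "A \<subseteq> D"
  proof
    fix a assume "a \<in> A"
    then have "[(1, a)] \<in> lists (UNIV \<times> A)" by simp
    moreover have "comb [(1, a)] = a" by (simp add: comb_def)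
    ultimately show "a \<in> D" unfolding D_def by (metis imageI)
  qed
  moreover have "subspace (closure D)"
  proof -
    have "comb [] \<in> D" unfolding D_def by (intro imageI) simp
    then have zero: "0 \<in> D" by (simp add: comb_def)
    have add: "x + y \<in> D" if xy: "x \<in> D" "y \<in> D" for x y
    proof -
      obtain l l' where l: "l \<in> lists (UNIV \<times> A)" "x = comb l" "l' \<in> lists (UNIV \<times> A)" "y = comb l'"
        using xy by (auto simp: D_def)
      then have "x + y = comb (l @ l')" by (simp add: comb_def)
      then show ?thesis using l unfolding D_def by simp
    qed
    have scale: "of_rat q *\<^sub>R x \<in> D" if x: "x \<in> D" for q x
    proof -
      obtain l where l: "l \<in> lists (UNIV \<times> A)" "x = comb l" using x by (auto simp: D_def)
      have "of_rat q *\<^sub>R comb l = comb (map (\<lambda>(r, a). (q * r, a)) l)" for l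
        by (induction l) (auto simp: comb_def scaleR_add_right of_rat_mult)
      moreover have "map (\<lambda>(r, a). (q * r, a)) l \<in> lists (UNIV \<times> A)"
        using l(1) by (auto simp: in_lists_conv_set)
      ultimately show ?thesis using l(2) unfolding D_def by (metis imageI)
    qed
    \<comment> \<open>Rational scaling is first extended to the closure, so that afterwards
      \<open>c\<close> can be approximated by rationals with the point \<open>x\<close> held
      fixed.\<close>
    have scale': "of_rat q *\<^sub>R x \<in> closure D" if "x \<in> closure D" for q x
    proof -
      obtain s where "\<And>n. s n \<in> D" "s \<longlonglongrightarrow> x" using \<open>x \<in> closure D\<close> by (auto simp: closure_sequential)
      then have "\<forall>n. of_rat q *\<^sub>R s n \<in> D" "(\<lambda>n. of_rat q *\<^sub>R s n) \<longlonglongrightarrow> of_rat q *\<^sub>R x"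
        by (auto intro: scale tendsto_intros)
      then show ?thesis unfolding closure_sequential by (intro exI conjI)
    qed
    show ?thesis
    proof (rule subspaceI)
      show "0 \<in> closure D" using zero closure_subset by blast
      fix x y assume x: "x \<in> closure D" and "y \<in> closure D"
      then obtain s t where "\<And>n. s n \<in> D" "s \<longlonglongrightarrow> x" "\<And>n. t n \<in> D" "t \<longlonglongrightarrow> y"
        by (auto simp: closure_sequential)
      then have "\<forall>n. s n + t n \<in> D" "(\<lambda>n. s n + t n) \<longlonglongrightarrow> x + y"
        by (auto intro: add tendsto_intros)
      then show "x + y \<in> closure D" unfolding closure_sequential by (intro exI conjI)
    next
      fix c :: real and x assume x: "x \<in> closure D"
      have "c \<in> closure \<rat>" by (simp add: Rats_closure_real)
      then obtain q where q: "\<And>n. q n \<in> \<rat>" "q \<longlonglongrightarrow> c" unfolding closure_sequential by blast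
      have "q n *\<^sub>R x \<in> closure D" for n
        using q(1)[of n] scale'[OF x] by (auto elim: Rats_cases)
      moreover have "(\<lambda>n. q n *\<^sub>R x) \<longlonglongrightarrow> c *\<^sub>R x" by (intro tendsto_intros q)
      ultimately show "c *\<^sub>R x \<in> closure D"
        by (rule closed_sequentially[OF closed_closure])
    qed
  qed
  ultimately show thesis by (rule that)
qed

text \<open>Norming functionals of the points of \<open>D\<close> suffice: if all of them vanish at
  \<open>z = x - y\<close>, then \<open>norm d = v d (d - z) \<le> norm (d - z)\<close> for
  \<open>d\<close> in \<open>D\<close>, and \<open>d\<close> can be chosen close to
  \<open>z\<close>, which lies in \<open>closure D\<close> because that is a subspace.\<close>

lemma countable_separating_functionals:
  fixes D :: "'a::real_normed_vector set"
  assumes D: "countable D" "D \<noteq> {}" and Y: "subspace (closure D)"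
  obtains u :: "nat \<Rightarrow> 'a \<Rightarrow> real" where "\<And>n. bounded_linear (u n)"
    "\<And>x y. x \<in> closure D \<Longrightarrow> y \<in> closure D \<Longrightarrow> (\<And>n. u n x = u n y) \<Longrightarrow> x = y"
proof -
  have "\<exists>u :: 'a \<Rightarrow> real. bounded_linear u \<and> (\<forall>x. \<bar>u x\<bar> \<le> norm x) \<and> u d = norm d" for d
    using norming_functional by metis
  then obtain v :: "'a \<Rightarrow> 'a \<Rightarrow> real"
    where v: "\<And>d. bounded_linear (v d)" "\<And>d x. \<bar>v d x\<bar> \<le> norm x" "\<And>d. v d d = norm d"
    by metis
  define u where "u = (\<lambda>n. v (from_nat_into D n))"
  show thesis
  proof (rule that)
    show bl: "bounded_linear (u n)" for n by (simp add: u_def v)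
    fix x y assume xy: "x \<in> closure D" "y \<in> closure D" and eq: "\<And>n. u n x = u n y"
    have vz: "v d (x - y) = 0" if d: "d \<in> D" for d
    proof -
      obtain n where "d = from_nat_into D n"
        using from_nat_into_surj[OF D(1) d] by metis
      then show ?thesis using eq[of n] linear_diff[OF bounded_linear.linear[OF v(1)]]
        by (simp add: u_def)
    qed
    have "x - y \<in> closure D" using Y xy by (rule subspace_diff)
    then have "norm (x - y) \<le> e" if "0 < e" for e
    proof -
      \<comment> \<open>The bound \<open>norm (x - y) \<le> norm d + norm (x - y - d)\<close> uses
        the approximation error twice, hence \<open>e / 2\<close>.\<close>
      obtain d where d: "d \<in> D" "dist d (x - y) < e / 2"
        using \<open>x - y \<in> closure D\<close> \<open>0 < e\<close> by (metis closure_approachable half_gt_zero)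
      have "norm d = v d (d - (x - y))"
        using vz[OF d(1)] v(3)[of d] linear_diff[OF bounded_linear.linear[OF v(1)]] by simp
      also have "\<dots> \<le> norm (d - (x - y))" using v(2)[of d "d - (x - y)"] by simp
      finally show ?thesis
        using d(2) norm_triangle_sub[of "x - y" d] by (simp add: dist_norm norm_minus_commute)
    qed
    then have "norm (x - y) \<le> 0" by (rule field_le_epsilon[where y = 0, simplified])
    then show "x = y" by simp
  qed
qed

context banach_space_over
begin

text \<open>
  This half of the Eberlein--Smulian theorem holds because a weakly compact subset of a separable
  closed subspace is mapped homeomorphically into the metrizable space of real sequences by any
  countable family of functionals that separates the points of the subspace.
\<close>

lemma weakly_compact_imp_weakly_seq_compact:
  assumes K: "compactin (weak_topology sc) K" and x: "\<And>n::nat. x n \<in> K"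
  obtains l r where "l \<in> K" "strict_mono (r :: nat \<Rightarrow> nat)"
    "limitin (weak_topology sc) (x \<circ> r) l sequentially"
proof -
  obtain D where D: "countable D" "range x \<subseteq> D" and Y: "Real_Vector_Spaces.subspace (closure D)"
    using countable_superset_subspace_closure[of "range x"] by auto
  then have "D \<noteq> {}" by auto
  then obtain u :: "nat \<Rightarrow> 'a \<Rightarrow> real" where u: "\<And>n. bounded_linear (u n)"
    "\<And>x y. x \<in> closure D \<Longrightarrow> y \<in> closure D \<Longrightarrow> (\<And>n. u n x = u n y) \<Longrightarrow> x = y"
    using countable_separating_functionals[OF D(1) _ Y] by blast
  define F where "F = (\<lambda>x n. u n x)"
  define L where "L = closure D \<inter> K"
  have xL: "x n \<in> L" for n
    using D(2) x closure_subset[of D] by (auto simp: L_def)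
  have L: "compactin (weak_topology sc) L"
    unfolding L_def by (rule closed_Int_compactin[OF closedin_weak_subspace[OF Y] K]) simp
  let ?X = "subtopology (weak_topology sc) L"
  let ?Z = "subtopology euclidean (F ` L)"
  have cont: "continuous_map (weak_topology sc) euclidean F"
    unfolding F_def euclidean_product_topology[symmetric] continuous_map_componentwise_UNIV
    using continuous_map_weak_real[OF u(1)] by blast
  then have contX: "continuous_map ?X ?Z F"
    by (auto simp: continuous_map_in_subtopology continuous_map_from_subtopology)
  \<comment> \<open>A continuous bijection from a compact space onto a Hausdorff space has a
    continuous inverse.\<close>
  have "homeomorphic_map ?X ?Z F"
  proof (rule continuous_imp_homeomorphic_map[OF contX])
    show "compact_space ?X" using L by (simp add: compact_space_subtopology)
    show "Hausdorff_space ?Z" by (simp add: Hausdorff_space_subtopology)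
    show "F ` topspace ?X = topspace ?Z" by simp
    show "inj_on F (topspace ?X)"
      by (auto simp: inj_on_def F_def L_def fun_eq_iff intro: u(2))
  qed
  then obtain G where G: "homeomorphic_maps ?X ?Z F G" unfolding homeomorphic_map_maps by blast
  have GF: "G (F y) = y" if "y \<in> L" for y
    using G that by (simp add: homeomorphic_maps_def)
  \<comment> \<open>The image lies in a countable power of the reals, where compactness implies
    sequential compactness; \<open>G\<close> then carries the convergent subsequence back to the
    weak topology.\<close>
  have "compact (F ` L)" using image_compactin[OF L cont] by simp
  then have "seq_compact (F ` L)" by (rule compact_imp_seq_compact)
  then obtain z r where z: "z \<in> F ` L" "strict_mono r" "((\<lambda>n. F (x n)) \<circ> r) \<longlonglongrightarrow> z"
    unfolding seq_compact_def using xL by (metis imageI)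
  have "limitin ?Z ((\<lambda>n. F (x n)) \<circ> r) z sequentially"
    using z xL by (auto simp: limitin_subtopology)
  then have "limitin ?X (G \<circ> ((\<lambda>n. F (x n)) \<circ> r)) (G z) sequentially"
    using G continuous_map_limit by (auto simp: homeomorphic_maps_def)
  moreover have "G \<circ> ((\<lambda>n. F (x n)) \<circ> r) = x \<circ> r" using GF xL by auto
  ultimately have "limitin (weak_topology sc) (x \<circ> r) (G z) sequentially"
    by (simp add: limitin_subtopology)
  moreover have "G z \<in> K" using z(1) GF by (auto simp: L_def)
  ultimately show thesis using that z(2) by blast
qed

section \<open>Comparison of the two quantities\<close>

lemma beta_le_alpha: "beta sc f \<le> alpha sc f"
  unfolding beta_def
proof (rule Sup_least, clarify)
  fix x :: "nat \<Rightarrow> 'a"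
  assume ball: "range x \<subseteq> cball 0 1" and lim: "limitin (weak_topology sc) x 0 sequentially"
  define K where "K = insert 0 (range x)"
  have "compactin (weak_topology sc) K"
    unfolding K_def by (rule compactin_sequence_with_limit[OF lim]) auto
  then have K: "K \<in> weakly_compact_ball_subsets sc"
    using ball by (simp add: weakly_compact_ball_subsets_def K_def)
  have "limsup (\<lambda>n. ereal (norm (f n (x n)))) \<le> limsup (\<lambda>n. SUP x\<in>K. ereal (norm (f n x)))"
    by (intro Limsup_mono always_eventually allI SUP_upper) (simp add: K_def)
  also have "\<dots> \<le> alpha sc f"
    unfolding alpha_def using K by (rule SUP_upper)
  finally show "limsup (\<lambda>n. ereal (norm (f n (x n)))) \<le> alpha sc f" .
qed

lemma le_betaI:
  assumes "range x \<subseteq> cball 0 1" "limitin (weak_topology sc) x 0 sequentially"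
    "c \<le> limsup (\<lambda>n. ereal (norm (f n (x n))))"
  shows "c \<le> beta sc f"
  using assms(3) by (rule order_trans) (use assms in \<open>auto simp: beta_def intro!: Sup_upper\<close>)

text \<open>\<open>beta\<close> pairs \<open>f n\<close> with the \<open>n\<close>-th term of a
  sequence, so a lower bound known only along the indices \<open>R k\<close> requires
  \<open>y\<close> to be spread out over all naturals.\<close>

lemma le_beta_subsequence:
  assumes R: "strict_mono (R :: nat \<Rightarrow> nat)" and y: "range y \<subseteq> cball 0 1"
    "limitin (weak_topology sc) y 0 sequentially"
    and lim: "(\<lambda>k. c k) \<longlonglongrightarrow> c0" and le: "\<And>k. c k \<le> norm (f (R k) (y k))"
  shows "ereal c0 \<le> beta sc f"
proof (rule le_betaI)
  \<comment> \<open>The term \<open>y k\<close> is moved to position \<open>R k\<close>; the zeros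
    elsewhere preserve both the ball condition and weak nullity, and passing from the subsequence to
    all indices can only raise the \<open>limsup\<close>.\<close>
  define w where "w = (\<lambda>n. if n \<in> range R then y (inv R n) else 0)"
  have wR: "w (R k) = y k" for k
    using R by (simp add: w_def strict_mono_imp_inj_on)
  show "range w \<subseteq> cball 0 1" using y(1) by (auto simp: w_def)
  show "limitin (weak_topology sc) w 0 sequentially"
    unfolding limitin_weak_topology
  proof
    fix g assume g: "g \<in> dual_space sc"
    then have "(\<lambda>k. g (y k)) \<longlonglongrightarrow> 0" using y(2) dual_spaceD(4)[OF g] by (metis limitin_weak_topology)
    have "(\<lambda>n. g (w n)) \<longlonglongrightarrow> 0"
    proof (rule LIMSEQ_I)
      fix e :: real assume "0 < e"
      then obtain N where N: "\<And>k. N \<le> k \<Longrightarrow> norm (g (y k)) < e"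
        using LIMSEQ_D[OF \<open>(\<lambda>k. g (y k)) \<longlonglongrightarrow> 0\<close>] by auto
      have "norm (g (w n)) < e" if "R N \<le> n" for n
      proof (cases "n \<in> range R")
        case True
        then obtain k where k: "n = R k" by blast
        then have "N \<le> k" using that R by (simp add: strict_mono_less_eq)
        then show ?thesis using N by (simp add: k wR)
      next
        case False
        then show ?thesis using \<open>0 < e\<close> dual_spaceD(4)[OF g] by (simp add: w_def)
      qed
      then show "\<exists>n0. \<forall>n\<ge>n0. norm (g (w n) - 0) < e" by auto
    qed
    then show "(\<lambda>n. g (w n)) \<longlonglongrightarrow> g 0" using dual_spaceD(4)[OF g] by simp
  qed
  have "ereal c0 = limsup (\<lambda>k. ereal (c k))"
    using lim by (intro lim_imp_Limsup[symmetric]) auto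
  also have "\<dots> \<le> limsup ((\<lambda>n. ereal (norm (f n (w n)))) \<circ> R)"
    using le by (intro Limsup_mono always_eventually) (simp add: wR)
  also have "\<dots> \<le> limsup (\<lambda>n. ereal (norm (f n (w n))))"
    using R by (rule limsup_subseq_mono)
  finally show "ereal c0 \<le> limsup (\<lambda>n. ereal (norm (f n (w n))))" .
qed

text \<open>Evaluation at \<open>x\<close> turns a neighbourhood of 0 in the scalar field into a
  subbasic neighbourhood of the zero functional.\<close>

lemma weak_star_null_pointwise:
  assumes "limitin (weak_star_topology sc) f (\<lambda>_. 0) sequentially"
  shows "(\<lambda>n. f n x) \<longlonglongrightarrow> 0"
proof (rule topological_tendstoI)
  fix U :: "'k set" assume U: "open U" "0 \<in> U"
  have "openin (weak_star_topology sc) {g \<in> dual_space sc. g x \<in> U}"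
    unfolding weak_star_topology_def using U by (intro topology_generated_by_Basis) blast
  then have "\<forall>\<^sub>F n in sequentially. f n \<in> {g \<in> dual_space sc. g x \<in> U}"
    using assms U zero_in_dual_space unfolding limitin_def by blast
  then show "\<forall>\<^sub>F n in sequentially. f n x \<in> U" by (rule eventually_mono) simp
qed

lemma alpha_le_two_beta:
  assumes dual: "\<And>n. f n \<in> dual_space sc" and null: "\<And>x. (\<lambda>n. f n x) \<longlonglongrightarrow> 0"
  shows "alpha sc f \<le> 2 * beta sc f"
  unfolding alpha_def
proof (rule SUP_least, rule dense_le)
  fix K and c :: ereal
  assume "K \<in> weakly_compact_ball_subsets sc"
    and c: "c < limsup (\<lambda>n. SUP x\<in>K. ereal (norm (f n x)))"
  then have ball: "K \<subseteq> cball 0 1" and K: "compactin (weak_topology sc) K"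
    by (auto simp: weakly_compact_ball_subsets_def)
  show "c \<le> 2 * beta sc f"
  proof (cases c)
    case (real b)
    \<comment> \<open>Taking \<open>c\<close> strictly below the \<open>limsup\<close> avoids any
      question of attainment: the suprema exceed \<open>c\<close> infinitely often, and each such
      supremum is witnessed by an actual point of \<open>K\<close>.\<close>
    have "infinite {n. c < (SUP x\<in>K. ereal (norm (f n x)))}"
    proof
      assume "finite {n. c < (SUP x\<in>K. ereal (norm (f n x)))}"
      then have "\<forall>\<^sub>F n in sequentially. (SUP x\<in>K. ereal (norm (f n x))) \<le> c"
        by (simp add: cofinite_eq_sequentially[symmetric] eventually_cofinite not_le)
      from Limsup_bounded[OF this] show False using c by simp
    qed
    from infinite_enumerate[OF this] obtain r :: "nat \<Rightarrow> nat"
      where r: "strict_mono r" "\<And>k. c < (SUP x\<in>K. ereal (norm (f (r k) x)))" by auto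
    then have "\<exists>x. x \<in> K \<and> b < norm (f (r k) x)" for k
      using r(2)[of k] by (auto simp: less_SUP_iff real)
    then obtain x where x: "\<And>k. x k \<in> K" "\<And>k. b < norm (f (r k) (x k))" by metis
    obtain l s where l: "l \<in> K" "strict_mono (s :: nat \<Rightarrow> nat)"
      "limitin (weak_topology sc) (x \<circ> s) l sequentially"
      by (rule weakly_compact_imp_weakly_seq_compact[OF K x(1)])
    define R where "R = r \<circ> s"
    \<comment> \<open>Both points lie in the unit ball, so their difference has norm at most 2;
      halving it is what costs the factor 2 in the conclusion.\<close>
    define y where "y = (\<lambda>k. (1/2) *\<^sub>R (x (s k) - l))"
    have R: "strict_mono R" unfolding R_def using r(1) l(2) by (rule strict_mono_o)
    have "norm (y k) \<le> 1" for k
    proof -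
      have "norm (x (s k)) \<le> 1" "norm l \<le> 1" using subsetD[OF ball x(1)[of "s k"]] subsetD[OF ball l(1)] by simp_all
      then show ?thesis
        using norm_triangle_ineq4[of "x (s k)" l] by (simp add: y_def)
    qed
    then have y1: "range y \<subseteq> cball 0 1" by auto
    have y2: "limitin (weak_topology sc) y 0 sequentially"
      unfolding limitin_weak_topology
    proof
      fix g assume g: "g \<in> dual_space sc"
      then have "(\<lambda>k. g (x (s k))) \<longlonglongrightarrow> g l" using l(3) by (simp add: limitin_weak_topology)
      then have "(\<lambda>k. of_real (1/2) * (g (x (s k)) - g l)) \<longlonglongrightarrow> of_real (1/2) * (g l - g l)"
        by (intro tendsto_intros)
      then show "(\<lambda>k. g (y k)) \<longlonglongrightarrow> g 0"
        by (simp only: y_def dual_spaceD[OF g] diff_self mult_zero_right)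
    qed
    have "(\<lambda>k. norm (f (R k) l)) \<longlonglongrightarrow> 0"
      using LIMSEQ_subseq_LIMSEQ[OF null[of l] R] by (auto simp: o_def intro: tendsto_norm_zero)
    \<comment> \<open>The reverse triangle inequality will leave \<open>b\<close> minus the
      contribution of the fixed point \<open>l\<close>, which tends to 0.\<close>
    then have "(\<lambda>k. (b - norm (f (R k) l)) / 2) \<longlonglongrightarrow> (b - 0) / 2" by (intro tendsto_intros) auto
    moreover have "(b - norm (f (R k) l)) / 2 \<le> norm (f (R k) (y k))" for k
    proof -
      have "f (R k) (y k) = of_real (1/2) * (f (R k) (x (s k)) - f (R k) l)"
        by (simp only: y_def dual_spaceD[OF dual])
      then have "norm (f (R k) (y k))
          = norm (of_real (1/2) :: 'k) * norm (f (R k) (x (s k)) - f (R k) l)"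
        by (simp only: norm_mult)
      then have "norm (f (R k) (y k)) = norm (f (R k) (x (s k)) - f (R k) l) / 2"
        by (simp only: norm_of_real)
      then show ?thesis
        using x(2)[of "s k"] norm_triangle_ineq2[of "f (R k) (x (s k))" "f (R k) l"]
        by (simp add: R_def)
    qed
    ultimately have "ereal (b / 2) \<le> beta sc f"
      using le_beta_subsequence[OF R y1 y2] by simp
    then have "2 * ereal (b / 2) \<le> 2 * beta sc f" by (rule ereal_mult_left_mono) simp
    then show ?thesis by (simp add: real)
  next
    case MInf
    then show ?thesis by simp
  next
    case PInf
    then show ?thesis using c by simp
  qed
qed

end

theorem lemma3p1:
  fixes sc :: "'k::real_or_complex_field \<Rightarrow> 'a::banach \<Rightarrow> 'a"
    and f :: "nat \<Rightarrow> 'a \<Rightarrow> 'k"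
  assumes "banach_space_over sc"
    and "infinite_dimensional sc"
    and "\<And>n. f n \<in> dual_space sc"
    and "limitin (weak_star_topology sc) f (\<lambda>_. 0) sequentially"
  shows "beta sc f \<le> alpha sc f \<and> alpha sc f \<le> 2 * beta sc f"
proof -
  interpret banach_space_over sc by (rule assms(1))
  show ?thesis
    using beta_le_alpha alpha_le_two_beta[OF assms(3) weak_star_null_pointwise[OF assms(4)]] by blast
qed

end
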